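(* Let $0<p<1$, $\lambda>0$, $F(x)=h(x)+g(x)$ on $\mathbb R^n$ with $g(x)=\lambda\|x\|_p^p$, where $h:\mathbb R^n\to\mathbb R$ is differentiable with an $L$-Lipschitz gradient for some $L>0$. Let $\alpha\in(0,1/L)$ and \[ Q_\alpha(y;x):=h(x)+\langle\nabla h(x),y-x\rangle+\frac1{2\alpha}\|y-x\|^2+g(y). \] Assume that $F$ is bounded below and that, for sequences $\delta_k,\eta_k\ge0$, the iterates $(x_k)_{k\ge0}$ in $\mathbb R^n$ and vectors $r_{k+1}\in\mathbb R^n$ satisfy, for all $k\ge0$, \[ Q_\alpha(x_{k+1};x_k)\le F(x_k)+\delta_k, \] \[ r_{k+1}\in\nabla h(x_k)+\frac1\alpha(x_{k+1}-x_k)+\partial g(x_{k+1}),\qquad \|r_{k+1}\|\le\eta_k. \] If $\sum_{k=0}^\infty\delta_k<\infty$ and $\eta_k\to0$, then, with $c_\alpha:=1/(2\alpha)-L/2>0$, \begin{align*} &F(x_{k+1})\le F(x_k)-c_\alpha\|x_{k+1}-x_k\|^2+\delta_k\quad\text{for all }k\ge 0,\\ &\sum_{k=0}^\infty\|x_{k+1}-x_k\|^2<\infty,\qquad F(x_k)\ \text{converges},\\ &\operatorname{dist}\bigl(0,\partial F(x_{k+1})\bigr)\le\eta_k+\Bigl(L+\frac1\alpha\Bigr)\|x_{k+1}-x_k\|\longrightarrow0. \end{align*} Consequently, every cluster point of $\{x_k\}$ is a critical point of $F$.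
   Context: $\|x\|_p^p:=\sum_{i=1}^n|x_i|^p$; $\|\cdot\|$ and $\langle\cdot,\cdot\rangle$ are the Euclidean norm and inner product. $\partial$ denotes the limiting (Mordukhovich) subdifferential: $v\in\partial f(x)$ iff there are $x^j\to x$ with $f(x^j)\to f(x)$ and $v^j\to v$ with $v^j$ a regular (Fréchet) subgradient of $f$ at $x^j$, i.e. $\liminf_{y\to x^j,\,y\ne x^j}\frac{f(y)-f(x^j)-\langle v^j,y-x^j\rangle}{\|y-x^j\|}\ge0$. A critical point of $F$ is a point $\bar x$ with $0\in\partial F(\bar x)$. $\operatorname{dist}(0,C):=\inf_{v\in C}\|v\|$. *)

theory Defs
  imports "HOL-Analysis.Analysis"
begin

text \<open>The punctured filter \<open>at x\<close> encodes \<open>y \<longlongrightarrow> x\<close>, \<open>y \<noteq> x\<close>. The lower limit is taken in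
  \<^typ>\<open>ereal\<close>, so that it always exists (possibly infinite).\<close>

definition regular_subdifferential :: "('a::real_inner \<Rightarrow> real) \<Rightarrow> 'a \<Rightarrow> 'a set" where
  "regular_subdifferential f x =
     {v. 0 \<le> Liminf (at x) (\<lambda>y. ereal ((f y - f x - v \<bullet> (y - x)) / norm (y - x)))}"

definition limiting_subdifferential :: "('a::real_inner \<Rightarrow> real) \<Rightarrow> 'a \<Rightarrow> 'a set" where
  "limiting_subdifferential f x =
     {v. \<exists>xs vs. xs \<longlonglongrightarrow> x \<and> (\<lambda>j. f (xs j)) \<longlonglongrightarrow> f x \<and> vs \<longlonglongrightarrow> v \<and>
         (\<forall>j. vs j \<in> regular_subdifferential f (xs j))}"

definition critical_point :: "('a::real_inner \<Rightarrow> real) \<Rightarrow> 'a \<Rightarrow> bool" where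
  "critical_point f x \<longleftrightarrow> 0 \<in> limiting_subdifferential f x"

text \<open>Valued in \<^typ>\<open>ereal\<close> so that the distance to the empty set is \<open>\<infinity>\<close>; the library's
  \<^const>\<open>infdist\<close> would give 0 there.\<close>

definition dist_zero :: "'a::real_normed_vector set \<Rightarrow> ereal" where
  "dist_zero C = (INF v\<in>C. ereal (norm v))"

definition cluster_point :: "(nat \<Rightarrow> 'a::topological_space) \<Rightarrow> 'a \<Rightarrow> bool" where
  "cluster_point x a \<longleftrightarrow> (\<exists>s. strict_mono s \<and> (x \<circ> s) \<longlonglongrightarrow> a)"

text \<open>The \<open>p\<close>-th power of the \<open>\<ell>\<^sub>p\<close> quasi-norm; \<open>0 powr p = 0\<close>, as it should be for \<open>p > 0\<close>.\<close>

definition lp_power :: "real \<Rightarrow> real^'n \<Rightarrow> real" where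
  "lp_power p x = (\<Sum>i\<in>UNIV. \<bar>x $ i\<bar> powr p)"

definition penalty :: "real \<Rightarrow> real \<Rightarrow> real^'n \<Rightarrow> real" where
  "penalty lam p x = lam * lp_power p x"

definition objective :: "(real^'n \<Rightarrow> real) \<Rightarrow> real \<Rightarrow> real \<Rightarrow> real^'n \<Rightarrow> real" where
  "objective h lam p x = h x + penalty lam p x"

text \<open>The argument \<open>h'\<close> stands for the gradient of \<open>h\<close>; the model is \<open>Q\<^sub>\<alpha>(y; x)\<close>.\<close>

definition prox_model ::
  "(real^'n \<Rightarrow> real) \<Rightarrow> (real^'n \<Rightarrow> real^'n) \<Rightarrow> real \<Rightarrow> real \<Rightarrow> real \<Rightarrow> real^'n \<Rightarrow> real^'n \<Rightarrow> real"
  where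
  "prox_model h h' lam p \<alpha> y x =
     h x + h' x \<bullet> (y - x) + 1 / (2 * \<alpha>) * (norm (y - x))\<^sup>2 + penalty lam p y"

end

theory Submission
  imports Defs
begin

text \<open>The Lipschitz gradient gives the descent lemma: \<open>h\<close> lies below its linearisation plus
  \<open>L / 2\<close> times the squared distance. The model carries the larger weight
  \<open>1 / (2 * \<alpha>)\<close> on the same squared distance, so an approximate descent of the model is a
  descent of the objective with \<open>1 / (2 * \<alpha>) - L / 2\<close> times the squared step to spare
  (\<open>objective_decrease\<close>). Telescoping this inequality, with a lower bound on the objective
  and summable errors, yields square-summable steps and convergence of the values
  (\<open>perturbed_descent\<close>).

  For stationarity, adding a \<open>C\<^sup>1\<close> function shifts the limiting subdifferential by its gradient
  (\<open>limiting_subdifferential_add_smooth\<close>). Evaluating the gradient of \<open>h\<close> at the new iterate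
  instead of the old one therefore turns the inexact optimality condition of the model into an
  actual subgradient of the objective, at the cost \<open>L * norm (x (Suc k) - x k)\<close>
  (\<open>subgradient_from_residual\<close>). These subgradients tend to zero. The objective is continuous
  because the exponent \<open>p\<close> is positive, so its values converge along convergent subsequences of
  iterates, and the graph of the limiting subdifferential is closed under such convergence
  (\<open>limiting_subdifferential_closed\<close>); hence zero is a subgradient at every cluster point.\<close>

section \<open>Calculus of regular and limiting subgradients\<close>

text \<open>Clearing the denominator in the lower limit gives a form in which subgradients can be added
  without arithmetic of extended reals.\<close>

lemma regular_subdifferential_iff:
  "v \<in> regular_subdifferential f x \<longleftrightarrow>
     (\<forall>e>0. \<forall>\<^sub>F y in at x. f y - f x - v \<bullet> (y - x) > - e * norm (y - x))"
proof -
  have quotient: "(- e < (f y - f x - v \<bullet> (y - x)) / norm (y - x)) \<longleftrightarrow>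
      (f y - f x - v \<bullet> (y - x) > - e * norm (y - x))" if "y \<noteq> x" for y e
    using that by (subst pos_less_divide_eq) auto
  have ev: "(\<forall>\<^sub>F y in at x. - e < (f y - f x - v \<bullet> (y - x)) / norm (y - x)) \<longleftrightarrow>
      (\<forall>\<^sub>F y in at x. f y - f x - v \<bullet> (y - x) > - e * norm (y - x))" for e
    by (rule eventually_cong[OF eventually_neq_at_within]) (rule quotient)
  have "v \<in> regular_subdifferential f x \<longleftrightarrow>
      (\<forall>b<0. \<forall>\<^sub>F y in at x. b < ereal ((f y - f x - v \<bullet> (y - x)) / norm (y - x)))"
    by (simp add: regular_subdifferential_def le_Liminf_iff)
  also have "\<dots> \<longleftrightarrow>
      (\<forall>e>0. \<forall>\<^sub>F y in at x. - e < (f y - f x - v \<bullet> (y - x)) / norm (y - x))"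
    (is "?l \<longleftrightarrow> ?r")
  proof
    assume l: ?l
    show ?r
    proof (intro allI impI)
      fix e :: real assume "e > 0"
      then show "\<forall>\<^sub>F y in at x. - e < (f y - f x - v \<bullet> (y - x)) / norm (y - x)"
        using l[rule_format, of "ereal (- e)"] by simp
    qed
  next
    assume r: ?r
    show ?l
    proof (intro allI impI)
      fix b :: ereal assume "b < 0"
      then obtain c :: real where c: "b < ereal c" "ereal c < 0"
        using ereal_dense2 by blast
      then have "\<forall>\<^sub>F y in at x. c < (f y - f x - v \<bullet> (y - x)) / norm (y - x)"
        using r[rule_format, of "- c"] by simp
      then show "\<forall>\<^sub>F y in at x. b < ereal ((f y - f x - v \<bullet> (y - x)) / norm (y - x))"
        by eventually_elim (use c in \<open>auto intro: less_trans\<close>)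
    qed
  qed
  finally show ?thesis by (simp only: ev)
qed

lemma regular_subdifferential_add_differentiable:
  assumes "GDERIV h x :> D" and "v \<in> regular_subdifferential g x"
  shows "D + v \<in> regular_subdifferential (\<lambda>y. h y + g y) x"
  unfolding regular_subdifferential_iff
proof (intro allI impI)
  fix e :: real assume e: "e > 0"
  have "(h has_derivative (\<lambda>z. z \<bullet> D)) (at x)"
    using assms(1) by (simp add: gderiv_def)
  then obtain d where d: "d > 0" and bound:
    "\<And>y. norm (y - x) < d \<Longrightarrow> norm (h y - h x - (y - x) \<bullet> D) \<le> e / 2 * norm (y - x)"
    using e unfolding has_derivative_at_alt by (meson half_gt_zero)
  have "\<forall>\<^sub>F y in at x. dist y x < d"
    using d unfolding eventually_at by blast
  moreover have "\<forall>\<^sub>F y in at x. g y - g x - v \<bullet> (y - x) > - (e / 2) * norm (y - x)"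
    using assms(2) e unfolding regular_subdifferential_iff by (meson half_gt_zero)
  ultimately show "\<forall>\<^sub>F y in at x. h y + g y - (h x + g x) - (D + v) \<bullet> (y - x) > - e * norm (y - x)"
  proof eventually_elim
    case (elim y)
    have "\<bar>h y - h x - D \<bullet> (y - x)\<bar> \<le> e / 2 * norm (y - x)"
      using bound[of y] elim(1) by (simp add: dist_norm inner_commute)
    then show ?case
      using elim(2) unfolding inner_add_left by argo
  qed
qed

text \<open>Continuity of the gradient is what lets the differentiable sum rule pass to the limit.\<close>

lemma limiting_subdifferential_add_smooth:
  assumes h: "\<And>z. GDERIV h z :> h' z" and cont: "continuous_on UNIV h'"
    and v: "v \<in> limiting_subdifferential g x"
  shows "h' x + v \<in> limiting_subdifferential (\<lambda>y. h y + g y) x"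
proof -
  obtain xs vs where lim: "xs \<longlonglongrightarrow> x" "(\<lambda>j. g (xs j)) \<longlonglongrightarrow> g x" "vs \<longlonglongrightarrow> v"
    and vs: "\<And>j. vs j \<in> regular_subdifferential g (xs j)"
    using v unfolding limiting_subdifferential_def by blast
  have "isCont h x"
    using h gderiv_def has_derivative_continuous by blast
  then have "(\<lambda>j. h (xs j)) \<longlonglongrightarrow> h x"
    using lim(1) isCont_tendsto_compose by blast
  moreover have "(\<lambda>j. h' (xs j)) \<longlonglongrightarrow> h' x"
    using lim(1) cont by (metis UNIV_I continuous_on_eq_continuous_at isCont_tendsto_compose open_UNIV)
  ultimately have "(\<lambda>j. h (xs j) + g (xs j)) \<longlonglongrightarrow> h x + g x"
    and "(\<lambda>j. h' (xs j) + vs j) \<longlonglongrightarrow> h' x + v"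
    using lim by (auto intro: tendsto_add)
  moreover have "h' (xs j) + vs j \<in> regular_subdifferential (\<lambda>y. h y + g y) (xs j)" for j
    using regular_subdifferential_add_differentiable[OF h vs] .
  ultimately show ?thesis
    using lim(1) unfolding limiting_subdifferential_def
    by (intro CollectI exI[of _ xs] exI[of _ "\<lambda>j. h' (xs j) + vs j"]) simp
qed

text \<open>Replacing the defining sequences by one approximant per tolerance makes diagonal arguments
  a matter of the triangle inequality.\<close>

lemma limiting_subdifferential_iff:
  "v \<in> limiting_subdifferential f x \<longleftrightarrow>
     (\<forall>e>0. \<exists>y u. dist y x < e \<and> dist (f y) (f x) < e \<and> dist u v < e \<and>
        u \<in> regular_subdifferential f y)"
  (is "?l \<longleftrightarrow> ?r")
proof
  assume ?l
  then obtain xs vs where lim: "xs \<longlonglongrightarrow> x" "(\<lambda>j. f (xs j)) \<longlonglongrightarrow> f x" "vs \<longlonglongrightarrow> v"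
    and vs: "\<And>j. vs j \<in> regular_subdifferential f (xs j)"
    unfolding limiting_subdifferential_def by blast
  show ?r
  proof (intro allI impI)
    fix e :: real assume "e > 0"
    then have "\<forall>\<^sub>F j in sequentially. dist (xs j) x < e \<and> dist (f (xs j)) (f x) < e \<and> dist (vs j) v < e"
      using lim by (intro eventually_conj tendstoD)
    then obtain j where "dist (xs j) x < e \<and> dist (f (xs j)) (f x) < e \<and> dist (vs j) v < e"
      using eventually_happens' sequentially_bot by blast
    then show "\<exists>y u. dist y x < e \<and> dist (f y) (f x) < e \<and> dist u v < e \<and>
        u \<in> regular_subdifferential f y"
      using vs by blast
  qed
next
  assume ?r
  then have "\<forall>j. \<exists>y u. dist y x < inverse (real (Suc j)) \<and> dist (f y) (f x) < inverse (real (Suc j)) \<and>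
      dist u v < inverse (real (Suc j)) \<and> u \<in> regular_subdifferential f y"
    by simp
  then obtain xs vs where near: "\<And>j. dist (xs j) x < inverse (real (Suc j))"
      "\<And>j. dist (f (xs j)) (f x) < inverse (real (Suc j))"
      "\<And>j. dist (vs j) v < inverse (real (Suc j))"
    and vs: "\<And>j. vs j \<in> regular_subdifferential f (xs j)"
    by metis
  have "xs \<longlonglongrightarrow> x"
    by (rule metric_tendsto_imp_tendsto[OF LIMSEQ_inverse_real_of_nat])
      (use near(1) in \<open>auto simp: less_imp_le\<close>)
  moreover have "(\<lambda>j. f (xs j)) \<longlonglongrightarrow> f x"
    by (rule metric_tendsto_imp_tendsto[OF LIMSEQ_inverse_real_of_nat])
      (use near(2) in \<open>auto simp: less_imp_le\<close>)
  moreover have "vs \<longlonglongrightarrow> v"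
    by (rule metric_tendsto_imp_tendsto[OF LIMSEQ_inverse_real_of_nat])
      (use near(3) in \<open>auto simp: less_imp_le\<close>)
  ultimately show ?l
    using vs unfolding limiting_subdifferential_def by blast
qed

lemma limiting_subdifferential_closed:
  assumes lim: "xs \<longlonglongrightarrow> x" "(\<lambda>j. f (xs j)) \<longlonglongrightarrow> f x" "vs \<longlonglongrightarrow> v"
    and vs: "\<And>j. vs j \<in> limiting_subdifferential f (xs j)"
  shows "v \<in> limiting_subdifferential f x"
  unfolding limiting_subdifferential_iff
proof (intro allI impI)
  fix e :: real assume e: "e > 0"
  then have "\<forall>\<^sub>F j in sequentially.
      dist (xs j) x < e / 2 \<and> dist (f (xs j)) (f x) < e / 2 \<and> dist (vs j) v < e / 2"
    using lim by (intro eventually_conj tendstoD) auto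
  then obtain j where j: "dist (xs j) x < e / 2" "dist (f (xs j)) (f x) < e / 2" "dist (vs j) v < e / 2"
    using eventually_happens' sequentially_bot by blast
  obtain y u where near: "dist y (xs j) < e / 2" "dist (f y) (f (xs j)) < e / 2" "dist u (vs j) < e / 2"
    and u: "u \<in> regular_subdifferential f y"
    using vs[of j] e unfolding limiting_subdifferential_iff by (meson half_gt_zero)
  have "dist y x < e" "dist (f y) (f x) < e" "dist u v < e"
    using near j dist_triangle[of y x "xs j"] dist_triangle[of "f y" "f x" "f (xs j)"]
      dist_triangle[of u v "vs j"] by linarith+
  then show "\<exists>y u. dist y x < e \<and> dist (f y) (f x) < e \<and> dist u v < e \<and>
      u \<in> regular_subdifferential f y"
    using u by blast
qed

section \<open>Descent with summable errors\<close>

text \<open>Along the segment from \<open>x\<close> to \<open>y\<close>, subtract from \<open>h\<close> its linearisation and the quadratic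
  bound: by the Lipschitz estimate the remainder has nonpositive slope.\<close>

lemma descent_lemma:
  fixes h :: "'a::real_inner \<Rightarrow> real"
  assumes h: "\<And>z. GDERIV h z :> h' z" and lip: "L-lipschitz_on UNIV h'"
  shows "h y \<le> h x + h' x \<bullet> (y - x) + L / 2 * (norm (y - x))\<^sup>2"
proof -
  let ?d = "y - x"
  let ?\<phi> = "\<lambda>t. h (x + t *\<^sub>R ?d) - t * (h' x \<bullet> ?d) - L / 2 * t\<^sup>2 * (norm ?d)\<^sup>2"
  have "?\<phi> 1 \<le> ?\<phi> 0"
  proof (rule DERIV_nonpos_imp_nonincreasing[where f = ?\<phi>])
    fix t :: real assume t: "0 \<le> t" "t \<le> 1"
    let ?z = "x + t *\<^sub>R ?d"
    have "(h has_derivative (\<lambda>u. u \<bullet> h' ?z)) (at ?z)"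
      using h by (simp add: gderiv_def)
    moreover have "((\<lambda>t. x + t *\<^sub>R ?d) has_derivative (\<lambda>s. s *\<^sub>R ?d)) (at t)"
      by (auto intro!: derivative_eq_intros)
    ultimately have "((\<lambda>t. h (x + t *\<^sub>R ?d)) has_derivative (\<lambda>s. (s *\<^sub>R ?d) \<bullet> h' ?z)) (at t)"
      by (rule has_derivative_compose[rotated])
    then have "((\<lambda>t. h (x + t *\<^sub>R ?d)) has_real_derivative h' ?z \<bullet> ?d) (at t)"
      by (simp add: has_field_derivative_def inner_commute mult_commute_abs)
    then have "(?\<phi> has_real_derivative h' ?z \<bullet> ?d - h' x \<bullet> ?d - L * t * (norm ?d)\<^sup>2) (at t)"
      by (auto intro!: derivative_eq_intros)
    moreover have "h' ?z \<bullet> ?d - h' x \<bullet> ?d - L * t * (norm ?d)\<^sup>2 \<le> 0"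
    proof -
      have "(h' ?z - h' x) \<bullet> ?d \<le> norm (h' ?z - h' x) * norm ?d"
        by (rule norm_cauchy_schwarz)
      also have "\<dots> \<le> L * (t * norm ?d) * norm ?d"
        using lipschitz_onD[OF lip, of ?z x] t by (intro mult_right_mono) (simp_all add: dist_norm)
      finally show ?thesis by (simp add: inner_diff_left power2_eq_square algebra_simps)
    qed
    ultimately show "\<exists>D. (?\<phi> has_real_derivative D) (at t) \<and> D \<le> 0" by blast
  qed simp
  then show ?thesis by simp
qed

text \<open>Subtracting the accumulated errors from the values makes them monotone; what remains is
  a telescoping sum.\<close>

lemma perturbed_descent:
  fixes f d \<delta> :: "nat \<Rightarrow> real"
  assumes c: "0 < c" and d: "\<And>k. 0 \<le> d k" and \<delta>: "\<And>k. 0 \<le> \<delta> k" "summable \<delta>"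
    and below: "\<And>k. m \<le> f k" and step: "\<And>k. f (Suc k) \<le> f k - c * d k + \<delta> k"
  shows "summable d" and "convergent f"
proof -
  define a where "a n = f n - (\<Sum>k<n. \<delta> k)" for n
  have a_step: "a (Suc n) \<le> a n - c * d n" for n
    using step[of n] by (simp add: a_def)
  have a_below: "m - suminf \<delta> \<le> a n" for n
    using below[of n] sum_le_suminf[OF \<delta>(2), of "{..<n}"] \<delta>(1) by (auto simp: a_def intro: diff_mono)
  have telescope: "c * (\<Sum>k<n. d k) \<le> a 0 - a n" for n
  proof (induction n)
    case (Suc n)
    then show ?case using a_step[of n] by (simp add: distrib_left)
  qed simp
  have "(\<Sum>k<n. d k) \<le> (a 0 - (m - suminf \<delta>)) / c" for n
    using telescope[of n] a_below[of n] c by (simp add: pos_le_divide_eq mult.commute)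
  then show "summable d"
    by (rule summableI_nonneg_bounded[OF d])
  have "decseq a"
    by (rule decseq_SucI) (use a_step c d in \<open>smt (verit) mult_nonneg_nonneg\<close>)
  then have "convergent a"
    using a_below decseq_convergent[of a] convergent_def by metis
  moreover have "convergent (\<lambda>n. \<Sum>k<n. \<delta> k)"
    using \<delta>(2) summable_iff_convergent by blast
  ultimately have "convergent (\<lambda>n. a n + (\<Sum>k<n. \<delta> k))"
    by (rule convergent_add)
  then show "convergent f" by (simp add: a_def)
qed

section \<open>Inexact proximal gradient steps for the penalised objective\<close>

lemma continuous_on_objective:
  assumes "0 < p" and h: "\<And>z. GDERIV h z :> h' z"
  shows "continuous_on UNIV (objective h lam p)"
proof -
  have cont_h: "continuous_on UNIV h"
    using h gderiv_def has_derivative_continuous by (metis continuous_at_imp_continuous_on)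
  have cont_powr: "continuous_on UNIV (\<lambda>z::real^'n. \<bar>z $ i\<bar> powr p)" for i
    using assms(1) by (intro continuous_on_powr' continuous_intros) auto
  show ?thesis
    unfolding objective_def[abs_def] penalty_def lp_power_def
    by (intro continuous_on_add continuous_on_mult continuous_on_const continuous_on_sum
        cont_h cont_powr)
qed

lemma objective_decrease:
  assumes h: "\<And>z. GDERIV h z :> h' z" and lip: "L-lipschitz_on UNIV h'"
    and model: "prox_model h h' lam p \<alpha> y x \<le> objective h lam p x + \<epsilon>"
  shows "objective h lam p y \<le>
    objective h lam p x - (1 / (2 * \<alpha>) - L / 2) * (norm (y - x))\<^sup>2 + \<epsilon>"
  using descent_lemma[OF h lip, of y x] model
  by (simp add: prox_model_def objective_def left_diff_distrib)

text \<open>The residual contains the gradient at the old point \<open>x\<close>, while a subgradient of the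
  objective at \<open>y\<close> needs the gradient at \<open>y\<close>. The exchange and the removal of the proximal term
  each cost a multiple of the step length.\<close>

lemma subgradient_from_residual:
  assumes h: "\<And>z. GDERIV h z :> h' z" and lip: "L-lipschitz_on UNIV h'" and "0 < \<alpha>"
    and r: "r \<in> (\<lambda>v. h' x + (1 / \<alpha>) *\<^sub>R (y - x) + v) ` limiting_subdifferential (penalty lam p) y"
    and norm_r: "norm r \<le> \<epsilon>"
  obtains w where "w \<in> limiting_subdifferential (objective h lam p) y"
    and "norm w \<le> \<epsilon> + (L + 1 / \<alpha>) * norm (y - x)"
proof -
  obtain v where v: "v \<in> limiting_subdifferential (penalty lam p) y"
    and r_eq: "r = h' x + (1 / \<alpha>) *\<^sub>R (y - x) + v"
    using r by blast
  have "h' y + v \<in> limiting_subdifferential (\<lambda>z. h z + penalty lam p z) y"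
    using limiting_subdifferential_add_smooth[OF h lipschitz_on_continuous_on[OF lip] v] .
  then have "h' y + v \<in> limiting_subdifferential (objective h lam p) y"
    by (simp add: objective_def[abs_def])
  moreover have "norm (h' y + v) \<le> \<epsilon> + (L + 1 / \<alpha>) * norm (y - x)"
  proof -
    have "h' y + v = r + (h' y - h' x) - (1 / \<alpha>) *\<^sub>R (y - x)"
      by (simp add: r_eq)
    also have "norm \<dots> \<le> norm r + norm (h' y - h' x) + norm ((1 / \<alpha>) *\<^sub>R (y - x))"
      by (meson add_right_mono norm_triangle_ineq norm_triangle_ineq4 order_trans)
    also have "\<dots> \<le> \<epsilon> + L * norm (y - x) + 1 / \<alpha> * norm (y - x)"
      using norm_r lipschitz_onD[OF lip, of y x] \<open>0 < \<alpha>\<close> by (intro add_mono) (auto simp: dist_norm)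
    finally show ?thesis by (simp add: algebra_simps)
  qed
  ultimately show thesis by (rule that)
qed

lemma dist_zero_le:
  assumes "w \<in> C" and "norm w \<le> b"
  shows "dist_zero C \<le> ereal b"
  using assms unfolding dist_zero_def by (meson INF_lower2 ereal_less_eq(3))

lemma dist_zero_nonneg: "0 \<le> dist_zero C"
  unfolding dist_zero_def by (intro INF_greatest) simp

text \<open>Dropping the first term of the subsequence ensures that every selected iterate has a
  predecessor, so it carries one of the given subgradients.\<close>

lemma cluster_point_critical:
  assumes cont: "continuous_on UNIV f" and lim: "w \<longlonglongrightarrow> 0"
    and w: "\<And>k. w k \<in> limiting_subdifferential f (x (Suc k))"
    and a: "cluster_point x a"
  shows "critical_point f a"
proof -
  obtain s where s: "strict_mono s" and xs: "(x \<circ> s) \<longlonglongrightarrow> a"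
    using a unfolding cluster_point_def by blast
  define q where "q k = s (Suc k) - 1" for k
  have "0 < s (Suc k)" for k
    using strict_monoD[OF s, of 0 "Suc k"] by simp
  then have q: "Suc (q k) = s (Suc k)" for k
    by (simp add: q_def)
  have "strict_mono q"
    unfolding strict_mono_Suc_iff
    by (metis Suc_less_eq lessI q s strict_monoD)
  then have wq: "(\<lambda>k. w (q k)) \<longlonglongrightarrow> 0"
    using LIMSEQ_subseq_LIMSEQ[OF lim] by (simp add: o_def)
  have xq: "(\<lambda>k. x (Suc (q k))) \<longlonglongrightarrow> a"
    using LIMSEQ_Suc[OF xs] by (simp add: q)
  have fq: "(\<lambda>k. f (x (Suc (q k)))) \<longlonglongrightarrow> f a"
    using continuous_on_tendsto_compose[OF cont xq] by simp
  show ?thesis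
    unfolding critical_point_def by (rule limiting_subdifferential_closed[OF xq fq wq w])
qed

theorem theorem5p9:
  fixes p lam L \<alpha> :: real
    and h :: "real^'n \<Rightarrow> real"
    and h' :: "real^'n \<Rightarrow> real^'n"
    and \<delta> \<eta> :: "nat \<Rightarrow> real"
    and x r :: "nat \<Rightarrow> real^'n"
  assumes "0 < p" and "p < 1" and "0 < lam" and "0 < L"
    and "\<And>z. GDERIV h z :> h' z"
    and "L-lipschitz_on UNIV h'"
    and "0 < \<alpha>" and "\<alpha> < 1 / L"
    and "bdd_below (range (objective h lam p))"
    and "\<And>k. 0 \<le> \<delta> k" and "\<And>k. 0 \<le> \<eta> k"
    and "\<And>k. prox_model h h' lam p \<alpha> (x (Suc k)) (x k) \<le> objective h lam p (x k) + \<delta> k"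
    and "\<And>k. r (Suc k) \<in> (\<lambda>v. h' (x k) + (1 / \<alpha>) *\<^sub>R (x (Suc k) - x k) + v) `
               limiting_subdifferential (penalty lam p) (x (Suc k))"
    and "\<And>k. norm (r (Suc k)) \<le> \<eta> k"
    and "summable \<delta>"
    and "\<eta> \<longlonglongrightarrow> 0"
  shows "0 < 1 / (2 * \<alpha>) - L / 2 \<and>
    (\<forall>k. objective h lam p (x (Suc k)) \<le>
         objective h lam p (x k) - (1 / (2 * \<alpha>) - L / 2) * (norm (x (Suc k) - x k))\<^sup>2 + \<delta> k) \<and>
    summable (\<lambda>k. (norm (x (Suc k) - x k))\<^sup>2) \<and>
    convergent (\<lambda>k. objective h lam p (x k)) \<and>
    (\<forall>k. dist_zero (limiting_subdifferential (objective h lam p) (x (Suc k))) \<le>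
         ereal (\<eta> k + (L + 1 / \<alpha>) * norm (x (Suc k) - x k))) \<and>
    (\<lambda>k. \<eta> k + (L + 1 / \<alpha>) * norm (x (Suc k) - x k)) \<longlonglongrightarrow> 0 \<and>
    (\<lambda>k. dist_zero (limiting_subdifferential (objective h lam p) (x (Suc k)))) \<longlonglongrightarrow> 0 \<and>
    (\<forall>a. cluster_point x a \<longrightarrow> critical_point (objective h lam p) a)"
proof -
  let ?F = "objective h lam p"
  let ?c = "1 / (2 * \<alpha>) - L / 2"
  let ?b = "\<lambda>k. \<eta> k + (L + 1 / \<alpha>) * norm (x (Suc k) - x k)"
  note h = assms(5) and lip = assms(6)
  have "L * \<alpha> < 1"
    using assms(4,8) by (simp add: pos_less_divide_eq mult.commute)
  then have c: "0 < ?c"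
    using assms(7) by (simp add: field_simps)
  have decrease: "?F (x (Suc k)) \<le> ?F (x k) - ?c * (norm (x (Suc k) - x k))\<^sup>2 + \<delta> k" for k
    by (rule objective_decrease[OF h lip assms(12)])
  obtain m where "\<And>z. m \<le> ?F z"
    using assms(9) by (auto simp: bdd_below_def)
  then have squares: "summable (\<lambda>k. (norm (x (Suc k) - x k))\<^sup>2)"
    and conv: "convergent (\<lambda>k. ?F (x k))"
    using perturbed_descent[where f = "\<lambda>k. ?F (x k)" and d = "\<lambda>k. (norm (x (Suc k) - x k))\<^sup>2",
        OF c zero_le_power2 assms(10,15) _ decrease] by blast+
  have "(\<lambda>k. sqrt ((norm (x (Suc k) - x k))\<^sup>2)) \<longlonglongrightarrow> sqrt 0"
    using summable_LIMSEQ_zero[OF squares] by (rule tendsto_real_sqrt)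
  then have steps: "(\<lambda>k. norm (x (Suc k) - x k)) \<longlonglongrightarrow> 0"
    by simp
  have bound_lim: "?b \<longlonglongrightarrow> 0"
    using tendsto_add[OF assms(16) tendsto_mult_right_zero[OF steps, of "L + 1 / \<alpha>"]] by simp
  have "\<exists>w. w \<in> limiting_subdifferential ?F (x (Suc k)) \<and> norm w \<le> ?b k" for k
    using subgradient_from_residual[OF h lip assms(7) assms(13,14)] by metis
  then obtain w where w: "\<And>k. w k \<in> limiting_subdifferential ?F (x (Suc k))"
    and norm_w: "\<And>k. norm (w k) \<le> ?b k"
    by metis
  have dist_le: "dist_zero (limiting_subdifferential ?F (x (Suc k))) \<le> ereal (?b k)" for k
    by (rule dist_zero_le[OF w norm_w])
  have dist_lim: "(\<lambda>k. dist_zero (limiting_subdifferential ?F (x (Suc k)))) \<longlonglongrightarrow> 0"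
  proof (rule tendsto_sandwich[OF _ _ tendsto_const])
    show "(\<lambda>k. ereal (?b k)) \<longlonglongrightarrow> 0"
      using bound_lim by (simp add: zero_ereal_def)
  qed (intro always_eventually allI dist_zero_nonneg dist_le)+
  have "w \<longlonglongrightarrow> 0"
    by (rule Lim_null_comparison[OF _ bound_lim]) (use norm_w in auto)
  then have "critical_point ?F a" if "cluster_point x a" for a
    using cluster_point_critical[OF continuous_on_objective[OF assms(1) h]] w that by blast
  then show ?thesis
    using c decrease squares conv dist_le bound_lim dist_lim by blast
qed

end
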